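(* Let $\ell, m, n$ be integers with $\ell \geq 1$, $m \geq 2$, $n \geq 5$, and $m \leq 4n$. Then \[ L_\ell = [L_m^{-1} \bmod L_n] \] if and only if one of the following holds: (d1) $\ell = \tfrac12(n \pm 1)$, $m = \tfrac12(n \mp 1)$ (with corresponding signs), and $n \equiv 1 \pmod 4$; or (d2) $\ell = \tfrac12(n+1)$, $m = \tfrac12(3n+1)$, and $n$ is odd; or (d3) $\ell = 1$ and $m = 2n - (-1)^n$; or (d4) $\ell = \tfrac12(n-1)$, $m = \tfrac12(5n+1)$, and $n \equiv 1 \pmod 4$; or (d5) $\ell = \tfrac12(n+1)$, $m = \tfrac12(5n-1)$, and $n \equiv 1 \pmod 4$; or (d6) $\ell = \tfrac12(n+1)$, $m = \tfrac12(7n+1)$, and $n$ is odd.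
   Context: $(L_n)$ is the Lucas sequence: $L_0 = 2$, $L_1 = 1$, and $L_n = L_{n-1} + L_{n-2}$ for $n \geq 2$; equivalently $L_n = \alpha^n + \beta^n$ with $\alpha = (1+\sqrt5)/2$, $\beta = (1-\sqrt5)/2$ (so $L_1 = 1, L_2 = 3, L_3 = 4, \dots$). For integers $a$ and $b \geq 1$ with $\gcd(a,b)=1$, $[a^{-1} \bmod b]$ denotes the unique $x \in \{0,1,\dots,b-1\}$ with $ax \equiv 1 \pmod b$; if $\gcd(a,b) > 1$, one sets $[a^{-1} \bmod b] := \infty$ (so in that case it is not equal to any Lucas number). *)

theory Defs
  imports
    Complex_Main
    "HOL-Number_Theory.Number_Theory"
    "HOL-Number_Theory.Modular_Inverse"
    "HOL-Library.Extended_Nat"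
begin

fun lucas :: "nat \<Rightarrow> nat" where
  "lucas 0 = 2"
| "lucas (Suc 0) = 1"
| "lucas (Suc (Suc n)) = lucas (Suc n) + lucas n"

(* The least nonnegative inverse of a modulo b, with value \<infinity> if a is not invertible modulo b.
   The library constant modular_inverse takes the modulus first and has value 0 in the
   non-invertible case. Only meaningful for b \<ge> 1. *)
definition inverse_mod :: "int \<Rightarrow> int \<Rightarrow> enat" where
  "inverse_mod a b = (if coprime a b then enat (nat (modular_inverse b a)) else \<infinity>)"

lemma inverse_mod_eq_enat_iff:
  assumes "b \<ge> 1"
  shows "inverse_mod a b = enat x \<longleftrightarrow> int x \<in> {0..b - 1} \<and> [a * int x = 1] (mod b)"
proof
  assume "inverse_mod a b = enat x"
  then have cop: "coprime a b" and x: "x = nat (modular_inverse b a)"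
    by (auto simp: inverse_mod_def split: if_splits)
  have "int x = modular_inverse b a"
    using x modular_inverse_int_nonneg[of b a] assms by simp
  then show "int x \<in> {0..b - 1} \<and> [a * int x = 1] (mod b)"
    using cong_modular_inverse1[OF cop] modular_inverse_int_less[of b a] assms by auto
next
  assume *: "int x \<in> {0..b - 1} \<and> [a * int x = 1] (mod b)"
  then have "modular_inverse b a = int x"
    by (intro modular_inverse_int_eqI) auto
  moreover have "coprime a b"
    using * coprime_iff_invertible_int by blast
  ultimately show "inverse_mod a b = enat x"
    by (simp add: inverse_mod_def)
qed

lemma inverse_mod_eq_infinity_iff: "inverse_mod a b = \<infinity> \<longleftrightarrow> gcd a b \<noteq> 1"
  by (simp add: inverse_mod_def coprime_iff_gcd_eq_1)

end

theory Submission
  imports Defs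
begin

text \<open>
  The product formula $L_{b+d} L_b = L_{2b+d} + (-1)^b L_d$ makes $L_m$ congruent to
  $\pm L_r$ modulo $L_n$, where $r \le n$ is the distance from $m$ to the nearest even
  multiple of $n$. It remains to solve $L_l L_r \equiv \pm 1$ for $l < n$, $r \le n$. The product
  formula, applied once or twice, rewrites $L_l L_r$ modulo $L_n$ as a signed sum of two Lucas
  numbers that is too small to differ from $\pm 1$ by a nonzero multiple of $L_n$. Hence
  the congruence is an equation between small Lucas numbers.
\<close>

section \<open>Lucas numbers: product formula and growth\<close>

abbreviation L :: "nat \<Rightarrow> int" where
  "L n \<equiv> int (lucas n)"

lemma lucas_binet:
  "real (lucas n) = ((1 + sqrt 5) / 2) ^ n + ((1 - sqrt 5) / 2) ^ n"
proof (induction n rule: lucas.induct)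
  case (3 n)
  have *: "x ^ Suc (Suc n) = x ^ Suc n + x ^ n" if "x\<^sup>2 = x + 1" for x :: real
  proof -
    have "x ^ Suc (Suc n) = x\<^sup>2 * x ^ n"
      by (simp add: power2_eq_square)
    with that show ?thesis
      by (simp add: algebra_simps)
  qed
  have "((1 + sqrt 5) / 2)\<^sup>2 = (1 + sqrt 5) / 2 + 1" "((1 - sqrt 5) / 2)\<^sup>2 = (1 - sqrt 5) / 2 + 1"
    by (simp_all add: power2_eq_square field_simps)
  then show ?case
    unfolding lucas.simps of_nat_add 3 by (simp only: * ac_simps)
qed (simp_all add: field_simps)

text \<open>In Binet form with \<open>x * y = -1\<close>, the two mixed terms of the product combine
  to \<open>(x * y) ^ b * (x ^ d + y ^ d)\<close>. Writing the larger index as \<open>b + d\<close>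
  avoids truncated subtraction.\<close>

lemma lucas_mult: "L (b + d) * L b = L (2 * b + d) + (-1) ^ b * L d"
proof -
  define x y :: real where "x = (1 + sqrt 5) / 2" and "y = (1 - sqrt 5) / 2"
  have lucas: "real (lucas k) = x ^ k + y ^ k" for k
    by (simp add: lucas_binet x_def y_def)
  have "x * y = -1"
    by (simp add: x_def y_def field_simps)
  then have *: "x ^ b * y ^ b = (-1) ^ b"
    by (metis power_mult_distrib)
  have "(x ^ (b + d) + y ^ (b + d)) * (x ^ b + y ^ b)
      = x ^ (2 * b + d) + y ^ (2 * b + d) + x ^ b * y ^ b * (x ^ d + y ^ d)"
    by (simp add: algebra_simps power_add power_mult power2_eq_square power_mult_distrib)
  then have "real_of_int (L (b + d) * L b) = real_of_int (L (2 * b + d) + (-1) ^ b * L d)"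
    by (simp add: lucas *)
  then show ?thesis
    by (simp only: of_int_eq_iff)
qed

lemma lucas_pos: "lucas n > 0"
  by (induction n rule: lucas.induct) auto

lemma lucas_rec: "n \<ge> 2 \<Longrightarrow> lucas n = lucas (n - 1) + lucas (n - 2)"
  by (cases n rule: lucas.cases) auto

lemma lucas_mono:
  assumes "1 \<le> a" "a \<le> b"
  shows "lucas a \<le> lucas b"
  using assms(2,1)
proof (induction rule: dec_induct)
  case (step k)
  then show ?case
    using lucas_rec[of "Suc k"] by simp
qed simp

text \<open>Monotonicity fails only at \<open>lucas 0 = 2 > lucas 1 = 1\<close>; this is why the
  larger index has to be at least 2, here and in the strict versions.\<close>

lemma lucas_le:
  assumes "a \<le> b" "b \<ge> 2"
  shows "lucas a \<le> lucas b"
proof (cases "a = 0")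
  case True
  then show ?thesis
    using lucas_mono[of 2 b] assms by (simp add: numeral_2_eq_2)
qed (use lucas_mono assms in auto)

lemma lucas_less:
  assumes "a < b" "b \<ge> 2"
  shows "lucas a < lucas b"
proof (cases "b = 2")
  case True
  then show ?thesis
    using assms by (auto simp: numeral_2_eq_2 less_Suc_eq)
next
  case False
  then show ?thesis
    using assms lucas_le[of a "b - 1"] lucas_rec[of b] lucas_pos[of "b - 2"] by fastforce
qed

lemma lucas_less_iff: "b \<ge> 2 \<Longrightarrow> lucas a < lucas b \<longleftrightarrow> a < b"
  using lucas_less[of a b] lucas_le[of b a] by (metis le_trans not_le)

lemma lucas_numerals:
  "lucas 2 = 3" "lucas 3 = 4" "lucas 4 = 7" "lucas 5 = 11"
  by (simp_all add: eval_nat_numeral)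

lemma lucas_eq_1: "lucas d = 1 \<Longrightarrow> d = 1"
  using lucas_le[of 2 d] lucas_numerals(1) 
  by (cases "d = 0 \<or> d \<ge> 2") auto

text \<open>Serves to rule out Lucas numbers that differ by 1 at indices of equal parity. The bound
  \<open>b \<ge> 3\<close> leaves out the one such pair, \<open>lucas 0 = 2\<close> and
  \<open>lucas 2 = 3\<close>. For \<open>b > 3\<close> the gap is at least
  \<open>lucas (b - 1)\<close>.\<close>

lemma lucas_diff_ge:
  assumes "a < b" "even a = even b" "b \<ge> 3"
  shows "lucas a + 2 \<le> lucas b"
proof -
  have "a \<le> b - 2"
    using assms by presburger
  show ?thesis
  proof (cases "b = 3")
    case True
    then have "a = 1"
      using assms by presburger
    then show ?thesis
      using True lucas_numerals by simp
  next
    case False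
    then have "lucas a \<le> lucas (b - 2)" "lucas (b - 1) \<ge> lucas 2"
      using assms \<open>a \<le> b - 2\<close> by (intro lucas_le; simp)+
    then show ?thesis
      using lucas_rec[of b] assms lucas_numerals by simp
  qed
qed

section \<open>Products of two Lucas numbers congruent to a unit\<close>

lemma dvd_less_imp_zero: "(a::int) dvd b \<Longrightarrow> \<bar>b\<bar> < a \<Longrightarrow> b = 0"
  using dvd_imp_le_int[of b a] by linarith

lemma lucas_mult_cong_unit_ge6:
  assumes "1 \<le> q" "q \<le> p" "p < n" "n \<ge> 6" and e: "e = 1 \<or> e = (-1::int)"
    and cong: "[L p * L q = e] (mod L n)"
  shows "p = 1 \<and> q = 1 \<and> e = 1 \<or> p + q = n \<and> p = q + 1 \<and> e = (-1) ^ q"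
proof -
  define d where "d = p - q"
  have prod: "L p * L q = L (p + q) + (-1) ^ q * L d"
    using lucas_mult[of q d] assms(2) by (simp add: d_def mult_2 add.commute)
  have dvd: "L n dvd L p * L q - e"
    using cong by (simp add: cong_iff_dvd_diff)
  have sgn: "(-1) ^ k = (1::int) \<or> (-1) ^ k = (-1::int)" for k :: nat
    by (cases "even k") auto
  \<comment> \<open>\<open>L n - L (n - 1) - L (n - 3) = L (n - 4)\<close>, so the estimate
    \<open>small\<close> needs \<open>L (n - 4) > 1\<close>; this is where \<open>n \<ge> 6\<close>
    enters.\<close>
  have "lucas (n - 4) \<ge> 3"
    using lucas_le[of 2 "n - 4"] assms lucas_numerals by simp
  then have small: "L (n - 1) + L (n - 3) + 1 < L n"
    using lucas_rec[of n] lucas_rec[of "n - 2"] assms by simp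
  consider "p + q < n" | "p + q = n" | "p + q > n"
    by linarith
  then show ?thesis
  proof cases
    case 1
    \<comment> \<open>Here \<open>d = (p + q) - 2 * q\<close> with \<open>q \<ge> 1\<close>, hence
      \<open>d \<le> n - 3\<close>.\<close>
    have "lucas (p + q) \<le> lucas (n - 1)" "lucas d \<le> lucas (n - 3)"
      using 1 assms by (intro lucas_le; simp add: d_def)+
    then have "L p * L q \<le> L (n - 1) + L (n - 3)"
      using prod sgn[of q] by auto
    moreover have "L p * L q > 0"
      using lucas_pos by simp
    ultimately have eq: "L p * L q = e"
      using dvd_less_imp_zero[OF dvd] small e by auto
    with \<open>L p * L q > 0\<close> e have "e = 1"
      by auto
    then have "lucas p = 1" "lucas q = 1"
      using eq by (metis nat_mult_eq_1_iff of_nat_1 of_nat_eq_iff of_nat_mult)+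
    then show ?thesis
      using lucas_eq_1 \<open>e = 1\<close> by blast
  next
    case 2
    have "L n dvd (-1) ^ q * L d - e"
      using dvd prod 2 by (metis add_diff_eq dvd_add_triv_left_iff)
    moreover have "lucas d \<le> lucas (n - 1)"
      using assms by (intro lucas_le) (auto simp: d_def)
    then have "\<bar>(-1) ^ q * L d - e\<bar> < L n"
      using small lucas_pos[of "n - 3"] e sgn[of q] by auto
    ultimately have eq: "(-1) ^ q * L d = e"
      using dvd_less_imp_zero by fastforce
    then have "d = 1"
      using lucas_eq_1[of d] e sgn[of q] by auto
    then show ?thesis
      using eq 2 by (auto simp: d_def)
  next
    case 3
    \<comment> \<open>\<open>L (p + q)\<close> is now too large. A second use of the product
      formula, with indices \<open>n\<close> and \<open>k\<close>, replaces it by a signed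
      \<open>L u\<close>, where \<open>u\<close> is the reflection of \<open>p + q\<close> in
      \<open>n\<close>.\<close>
    define k u where "k = p + q - n" and "u = 2 * n - (p + q)"
    have u: "2 \<le> u" "u \<le> n - 1" "even u = even d" and d: "d \<le> n - 3"
      using 3 assms by (auto simp: u_def d_def)
    have "L n * L k = L (p + q) + (-1) ^ k * L u"
      using lucas_mult[of k u] 3 assms by (simp add: k_def u_def algebra_simps)
    then have "L p * L q - e = L n * L k + ((-1) ^ q * L d - (-1) ^ k * L u - e)"
      using prod by simp
    then have "L n dvd (-1) ^ q * L d - (-1) ^ k * L u - e"
      using dvd by (metis dvd_add_triv_left_iff dvd_add_right_iff dvd_triv_left)
    moreover have "lucas u \<le> lucas (n - 1)" "lucas d \<le> lucas (n - 3)"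
      using u d assms by (intro lucas_le; simp)+
    then have "\<bar>(-1) ^ q * L d - (-1) ^ k * L u - e\<bar> < L n"
      using small e sgn[of q] sgn[of k] by auto
    ultimately have eq: "(-1) ^ q * L d - (-1) ^ k * L u = e"
      using dvd_less_imp_zero by fastforce
    \<comment> \<open>Terms of equal sign would add up to at least 2 in absolute value, or to
      exactly 1 only if one of them vanished, so the signs are opposite.\<close>
    then have near: "\<bar>L d - L u\<bar> = 1"
      using e sgn[of q] sgn[of k] lucas_pos[of d] lucas_pos[of u] by auto
    have "u = 2"
    proof (rule ccontr)
      assume "u \<noteq> 2"
      then have "u \<ge> 3"
        using u by simp
      with near u show False
        using lucas_diff_ge[of u d] lucas_diff_ge[of d u]
        by (cases u d rule: linorder_cases) simp_all
    qed
    then have "d \<noteq> 2" "\<not> d > 2"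
      using near u lucas_diff_ge[of u d] by auto
    then have "d = 0"
      using u \<open>u = 2\<close> by presburger
    then have "p = n - 1" "q = n - 1"
      using \<open>u = 2\<close> assms by (auto simp: u_def d_def)
    \<comment> \<open>In the surviving case \<open>u = 2\<close>, \<open>d = 0\<close> the two terms
      have the same sign after all, so they give 5 or -5 instead of \<open>e\<close>.\<close>
    then have "odd (q + k)"
      using assms by (auto simp: k_def)
    then have "(-1) ^ q = - ((-1) ^ k :: int)"
      by (auto simp: even_add)
    then show ?thesis
      using eq e sgn[of k] \<open>u = 2\<close> \<open>d = 0\<close> lucas_numerals by auto
  qed
qed

text \<open>
  For \<open>n = 5\<close> the size estimate fails, because \<open>L\<^sub>4 + L\<^sub>2 + 1 = L\<^sub>5\<close>.
  Here \<open>L\<^sub>4 L\<^sub>2 = 21\<close> is a sporadic solution of the congruence with \<open>-1\<close>;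
  it does not lead to an inverse, since for odd \<open>n\<close> the sign \<open>-1\<close> in \<open>L\<^sub>m \<equiv> \<plusminus>L\<^sub>r\<close> requires \<open>r\<close> to be odd.
\<close>

lemma lucas_mult_cong_unit:
  assumes "1 \<le> q" "q \<le> p" "p < n" "n \<ge> 5" and e: "e = 1 \<or> e = (-1::int)"
    and exc: "n = 5 \<Longrightarrow> e = -1 \<Longrightarrow> odd p \<or> odd q"
  shows "[L p * L q = e] (mod L n) \<longleftrightarrow>
    p = 1 \<and> q = 1 \<and> e = 1 \<or> p + q = n \<and> p = q + 1 \<and> e = (-1) ^ q"
proof
  assume cong: "[L p * L q = e] (mod L n)"
  show "p = 1 \<and> q = 1 \<and> e = 1 \<or> p + q = n \<and> p = q + 1 \<and> e = (-1) ^ q"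
  proof (cases "n = 5")
    case True
    then have "p \<in> {1,2,3,4}" "q \<in> {1,2,3,4}"
      using assms by auto
    then show ?thesis
      using e assms(2) cong exc[OF True] unfolding True
      by (elim disjE insertE emptyE) (simp_all add: cong_def lucas_numerals)
  next
    case False
    then show ?thesis
      using lucas_mult_cong_unit_ge6[OF assms(1-3) _ e cong] assms by simp
  qed
next
  assume "p = 1 \<and> q = 1 \<and> e = 1 \<or> p + q = n \<and> p = q + 1 \<and> e = (-1) ^ q"
  then show "[L p * L q = e] (mod L n)"
  proof
    assume "p + q = n \<and> p = q + 1 \<and> e = (-1) ^ q"
    then have "L p * L q - e = L n"
      using lucas_mult[of q 1] by (auto simp: mult_2)
    then show ?thesis
      by (simp add: cong_iff_dvd_diff)
  qed auto
qed

text \<open>These are the values of \<open>r\<close> that the size argument does not cover. For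
  \<open>r = n\<close> the product vanishes modulo \<open>L n\<close>; for \<open>r = 0\<close> it
  is \<open>2 * L l\<close>, since \<open>lucas 0 = 2\<close>.\<close>

lemma lucas_mult_cong_unit_boundary:
  assumes "1 \<le> l" "l < n" "n \<ge> 5" and e: "e = 1 \<or> e = (-1::int)" and r: "r = 0 \<or> r = n"
  shows "\<not> [L l * L r = e] (mod L n)"
proof
  assume "[L l * L r = e] (mod L n)"
  then have dvd: "L n dvd L l * L r - e"
    by (simp add: cong_iff_dvd_diff)
  have "lucas n \<ge> 11"
    using lucas_le[of 5 n] assms lucas_numerals by simp
  show False
  proof (cases "r = n")
    case True
    then have "L n dvd e"
      using dvd by (metis dvd_diff_right_iff dvd_triv_right)
    then show False
      using dvd_less_imp_zero[of "L n" e] e \<open>lucas n \<ge> 11\<close> by auto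
  next
    case False
    then have dvd: "L n dvd 2 * L l - e"
      using dvd r by (simp add: mult.commute)
    have rec: "lucas n = lucas (n - 1) + lucas (n - 2)" "lucas (n - 1) = lucas (n - 2) + lucas (n - 3)"
      using lucas_rec[of n] lucas_rec[of "n - 1"] assms by (simp_all add: numeral_eq_Suc)
    have ge3: "lucas (n - 3) \<ge> 3" "lucas (n - 2) > 0"
      using lucas_le[of 2 "n - 3"] lucas_pos assms lucas_numerals by auto
    show False
    proof (cases "l = n - 1")
      case True
      \<comment> \<open>Only for \<open>l = n - 1\<close> can \<open>2 * L l\<close> exceed
        \<open>L n\<close>; the excess is \<open>L (n - 3)\<close>.\<close>
      have "L n dvd 2 * L l - e - L n"
        using dvd by simp
      also have "2 * L l - e - L n = L (n - 3) - e"
        using rec True by simp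
      finally have "L (n - 3) - e = 0"
        using dvd_less_imp_zero rec ge3 e by fastforce
      then show False
        using ge3 e by linarith
    next
      case False
      then have "lucas l \<le> lucas (n - 2)"
        using lucas_le[of l "n - 2"] assms by linarith
      then have "\<bar>2 * L l - e\<bar> < L n"
        using rec ge3 e by linarith
      then have "2 * L l - e = 0"
        using dvd dvd_less_imp_zero by blast
      then show False
        using lucas_pos[of l] e by linarith
    qed
  qed
qed

lemma lucas_mult_cong_unit_iff:
  assumes "1 \<le> l" "l < n" "r \<le> n" "n \<ge> 5" and e: "e = 1 \<or> e = (-1::int)"
    and exc: "n = 5 \<Longrightarrow> e = -1 \<Longrightarrow> odd l \<or> odd r"
  shows "[L l * L r = e] (mod L n) \<longleftrightarrow>
    l = 1 \<and> r = 1 \<and> e = 1 \<or> l + r = n \<and> (l = r + 1 \<or> r = l + 1) \<and> e = (-1) ^ min l r"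
proof (cases "r = 0 \<or> r = n")
  case True
  then show ?thesis
    using lucas_mult_cong_unit_boundary[OF assms(1,2,4) e] assms by auto
next
  case False
  show ?thesis
  proof (cases "r \<le> l")
    case True
    then show ?thesis
      using False assms lucas_mult_cong_unit[of r l n e] exc by (auto simp: min_def)
  next
    case r: False
    then show ?thesis
      using False assms lucas_mult_cong_unit[of l r n e] exc by (auto simp: min_def ac_simps)
  qed
qed

section \<open>Reduction of the index modulo \<open>L n\<close>\<close>

lemma cong_lucas_add_2n: "[L (2 * n + r) = - ((-1) ^ n) * L r] (mod L n)"
proof -
  have "L (2 * n + r) - - ((-1) ^ n) * L r = L (n + r) * L n"
    using lucas_mult[of n r] by simp
  then show ?thesis
    by (simp add: cong_iff_dvd_diff)
qed

text \<open>The product formula with \<open>b = n - r\<close> and \<open>d = r\<close>.\<close>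

lemma cong_lucas_2n_diff:
  assumes "r \<le> n"
  shows "[L (2 * n - r) = - ((-1) ^ (n + r)) * L r] (mod L n)"
proof -
  have "L n * L (n - r) = L (2 * n - r) + (-1) ^ (n - r) * L r"
    using lucas_mult[of "n - r" r] assms by (simp add: algebra_simps)
  moreover have "(-1) ^ (n - r) = ((-1) ^ (n + r) :: int)"
    using assms by (simp add: minus_one_power_iff)
  ultimately have "L (2 * n - r) - - ((-1) ^ (n + r)) * L r = L n * L (n - r)"
    by simp
  then show ?thesis
    by (simp add: cong_iff_dvd_diff)
qed

text \<open>A shift by \<open>2 * n\<close> followed by a reflection; the two factors
  \<open>(-1) ^ n\<close> cancel.\<close>

lemma cong_lucas_4n_diff:
  assumes "r \<le> n"
  shows "[L (4 * n - r) = (-1) ^ r * L r] (mod L n)"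
proof -
  have "2 * n + (2 * n - r) = 4 * n - r"
    using assms by simp
  then have "[L (4 * n - r) = - ((-1) ^ n) * L (2 * n - r)] (mod L n)"
    using cong_lucas_add_2n[of n "2 * n - r"] by metis
  also have "[- ((-1) ^ n) * L (2 * n - r) = - ((-1) ^ n) * (- ((-1) ^ (n + r)) * L r)] (mod L n)"
    by (intro cong_mult cong_refl cong_lucas_2n_diff assms)
  also have "- ((-1) ^ n) * (- ((-1) ^ (n + r)) * L r) = (-1) ^ r * L r"
    by (simp add: power_add flip: mult.assoc)
  finally show ?thesis .
qed

text \<open>The sign is encoded by the truth value \<open>P\<close>, which makes the later matching
  of parities propositional. As the sign squares to 1, it can be moved to the right-hand side of the
  congruence.\<close>

lemma lucas_mult_cong_1_iff:
  assumes "1 \<le> l" "l < n" "r \<le> n" "n \<ge> 5"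
    and m: "[L m = (if P then 1 else -1) * L r] (mod L n)" and exc: "odd n \<Longrightarrow> \<not> P \<Longrightarrow> odd r"
  shows "[L m * L l = 1] (mod L n) \<longleftrightarrow>
    l = 1 \<and> r = 1 \<and> P \<or> l + r = n \<and> (l = r + 1 \<and> P = even r \<or> r = l + 1 \<and> P = even l)"
proof -
  define e :: int where "e = (if P then 1 else -1)"
  have e: "e = 1 \<or> e = -1" and exc': "n = 5 \<Longrightarrow> e = -1 \<Longrightarrow> odd l \<or> odd r"
    using exc by (auto simp: e_def split: if_splits)
  have "[L m * L l = e * (L l * L r)] (mod L n)"
    using cong_scalar_right[OF m, of "L l"] by (simp add: ac_simps e_def)
  then have "[L m * L l = 1] (mod L n) \<longleftrightarrow> [e * (L l * L r) = 1] (mod L n)"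
    by (meson cong_sym cong_trans)
  also have "\<dots> \<longleftrightarrow> [L l * L r = e] (mod L n)"
    using e cong_minus_minus_iff[of "L l * L r" "-1" "L n"] by auto
  also have "\<dots> \<longleftrightarrow> l = 1 \<and> r = 1 \<and> e = 1 \<or>
      l + r = n \<and> (l = r + 1 \<or> r = l + 1) \<and> e = (-1) ^ min l r"
    using lucas_mult_cong_unit_iff[OF assms(1-4) e exc'] by simp
  also have "\<dots> \<longleftrightarrow>
      l = 1 \<and> r = 1 \<and> P \<or> l + r = n \<and> (l = r + 1 \<and> P = even r \<or> r = l + 1 \<and> P = even l)"
    by (auto simp: e_def minus_one_power_iff split: if_splits)
  finally show ?thesis .
qed

text \<open>One alternative for each of the four ranges of length \<open>n\<close>. The bounds on
  \<open>r\<close> keep the alternatives disjoint at the endpoints.\<close>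

lemma cong_lucas_cases:
  assumes "m \<le> 4 * n" "n \<ge> 1"
  obtains r P where "r \<le> n" "[L m = (if P then 1 else -1) * L r] (mod L n)" "odd n \<Longrightarrow> \<not> P \<Longrightarrow> odd r"
    "m = r \<and> P \<or> m + r = 2 * n \<and> r < n \<and> P = odd (n + r) \<or>
     m = 2 * n + r \<and> 1 \<le> r \<and> P = odd n \<or> m + r = 4 * n \<and> r < n \<and> P = even r"
proof -
  consider "m \<le> n" | "n < m" "m \<le> 2 * n" | "2 * n < m" "m \<le> 3 * n" | "3 * n < m"
    by linarith
  then show ?thesis
  proof cases
    case 1
    then show ?thesis
      using that[of m True] by simp
  next
    case 2
    define r where "r = 2 * n - m"
    have r: "r < n" "m = 2 * n - r"
      using 2 by (auto simp: r_def)
    have "[L m = (if odd (n + r) then 1 else -1) * L r] (mod L n)"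
      using cong_lucas_2n_diff[of r n] r by (cases "even (n + r)") (simp_all add: minus_one_power_iff)
    then show ?thesis
      using that[of r "odd (n + r)"] r by auto
  next
    case 3
    define r where "r = m - 2 * n"
    have r: "1 \<le> r" "r \<le> n" "m = 2 * n + r"
      using 3 by (auto simp: r_def)
    have "[L m = (if odd n then 1 else -1) * L r] (mod L n)"
      using cong_lucas_add_2n[of n r] r by (cases "even n") simp_all
    then show ?thesis
      using that[of r "odd n"] r by auto
  next
    case 4
    define r where "r = 4 * n - m"
    have r: "r < n" "m = 4 * n - r"
      using 4 assms by (auto simp: r_def)
    have "[L m = (if even r then 1 else -1) * L r] (mod L n)"
      using cong_lucas_4n_diff[of r n] r by (cases "even r") simp_all
    then show ?thesis
      using that[of r "even r"] r by auto
  qed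
qed

section \<open>Solutions according to the parity of \<open>n\<close>\<close>

lemma lucas_mult_cong_1_even:
  assumes "1 \<le> l" "l < n" "2 \<le> m" "m \<le> 4 * n" "n \<ge> 5" "even n"
  shows "[L m * L l = 1] (mod L n) \<longleftrightarrow> l = 1 \<and> m + 1 = 2 * n"
proof -
  obtain r P where r: "r \<le> n" "[L m = (if P then 1 else -1) * L r] (mod L n)" "odd n \<Longrightarrow> \<not> P \<Longrightarrow> odd r"
    and m: "m = r \<and> P \<or> m + r = 2 * n \<and> r < n \<and> P = odd (n + r) \<or>
     m = 2 * n + r \<and> 1 \<le> r \<and> P = odd n \<or> m + r = 4 * n \<and> r < n \<and> P = even r"
    using cong_lucas_cases[of m n] assms by auto
  \<comment> \<open>Consecutive indices have an odd sum.\<close>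
  have "\<not> (l + r = n \<and> (l = r + 1 \<or> r = l + 1))"
    using \<open>even n\<close> by presburger
  then have "[L m * L l = 1] (mod L n) \<longleftrightarrow> l = 1 \<and> r = 1 \<and> P"
    using lucas_mult_cong_1_iff[OF assms(1,2) r(1) assms(5) r(2,3)] by blast
  \<comment> \<open>Of the candidates 1, \<open>2 * n - 1\<close>, \<open>2 * n + 1\<close> and
    \<open>4 * n - 1\<close> for \<open>m\<close>, the first is below 2 and the last two carry the
    sign -1.\<close>
  also have "r = 1 \<and> P \<longleftrightarrow> m + 1 = 2 * n"
  proof
    assume "r = 1 \<and> P"
    then show "m + 1 = 2 * n"
      using m assms by auto
  next
    assume *: "m + 1 = 2 * n"
    then have "r = 1"
      using m assms r(1) by linarith
    then show "r = 1 \<and> P"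
      using m assms * by auto
  qed
  finally show ?thesis .
qed

text \<open>The consecutive indices with sum \<open>n\<close> are \<open>k\<close> and
  \<open>k + 1\<close>, and both orders require the sign \<open>(-1) ^ k\<close>. Each range of
  \<open>m\<close> then contributes its own solutions.\<close>

lemma lucas_mult_cong_1_odd:
  assumes "1 \<le> l" "l < n" "2 \<le> m" "m \<le> 4 * n" "n \<ge> 5" "n = 2 * k + 1"
  shows "[L m * L l = 1] (mod L n) \<longleftrightarrow>
    l = k + 1 \<and> m = k \<and> even k \<or> l = k \<and> m = k + 1 \<and> even k \<or> l = k + 1 \<and> m = 3 * k + 2 \<or>
    l = 1 \<and> m = 2 * n + 1 \<or> l = k \<and> m = 5 * k + 3 \<and> even k \<or> l = k + 1 \<and> m = 5 * k + 2 \<and> even k \<or>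
    l = k + 1 \<and> m = 7 * k + 4"
    (is "_ \<longleftrightarrow> ?R")
proof -
  obtain r P where r: "r \<le> n" "[L m = (if P then 1 else -1) * L r] (mod L n)" "odd n \<Longrightarrow> \<not> P \<Longrightarrow> odd r"
    and m: "m = r \<and> P \<or> m + r = 2 * n \<and> r < n \<and> P = odd (n + r) \<or>
     m = 2 * n + r \<and> 1 \<le> r \<and> P = odd n \<or> m + r = 4 * n \<and> r < n \<and> P = even r"
    using cong_lucas_cases[of m n] assms by auto
  have "[L m * L l = 1] (mod L n) \<longleftrightarrow>
      l = 1 \<and> r = 1 \<and> P \<or> l + r = n \<and> (l = r + 1 \<and> P = even r \<or> r = l + 1 \<and> P = even l)"
    by (rule lucas_mult_cong_1_iff[OF assms(1,2) r(1) assms(5) r(2,3)])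
  also have "\<dots> \<longleftrightarrow>
      l = 1 \<and> r = 1 \<and> P \<or> l = k + 1 \<and> r = k \<and> P = even k \<or> l = k \<and> r = k + 1 \<and> P = even k"
  proof -
    have "l + r = n \<and> l = r + 1 \<longleftrightarrow> l = k + 1 \<and> r = k" "l + r = n \<and> r = l + 1 \<longleftrightarrow> l = k \<and> r = k + 1"
      using \<open>n = 2 * k + 1\<close> by auto
    then show ?thesis
      by metis
  qed
  also have "\<dots> \<longleftrightarrow> ?R"
    using m
  proof (elim disjE conjE)
    assume *: "m = r" "P"
    then have "m \<noteq> 3 * k + 2" "m \<noteq> 5 * k + 2" "m \<noteq> 7 * k + 4" "m \<noteq> 5 * k + 3" "m \<noteq> 2 * n + 1" "r \<noteq> 1"
      using r(1) assms(3,5,6) by linarith+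
    then show ?thesis
      using * by blast
  next
    \<comment> \<open>The sign is that of \<open>even r\<close>, so \<open>r = k\<close> fits for
      every \<open>k\<close>, whereas \<open>r = k + 1\<close> and \<open>r = 1\<close> never
      fit.\<close>
    assume *: "m + r = 2 * n" "r < n" "P = odd (n + r)"
    then have "m \<noteq> k" "m = 3 * k + 2 \<longleftrightarrow> r = k" "m \<noteq> 5 * k + 2" "m \<noteq> 7 * k + 4" "m \<noteq> k + 1" "m \<noteq> 5 * k + 3" "m \<noteq> 2 * n + 1"
      using r(1) assms(5,6) by linarith+
    moreover have "P = even r"
      using * assms by simp
    ultimately show ?thesis
      by auto
  next
    assume *: "m = 2 * n + r" "1 \<le> r" "P = odd n"
    then have "m \<noteq> k" "m \<noteq> 3 * k + 2" "m = 5 * k + 2 \<longleftrightarrow> r = k" "m \<noteq> 7 * k + 4" "m \<noteq> k + 1"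
        "m = 5 * k + 3 \<longleftrightarrow> r = k + 1" "m = 2 * n + 1 \<longleftrightarrow> r = 1"
      using r(1) assms(5,6) by linarith+
    moreover have "P"
      using * assms by simp
    ultimately show ?thesis
      by blast
  next
    \<comment> \<open>The same sign pattern as for \<open>m + r = 2 * n\<close>.\<close>
    assume *: "m + r = 4 * n" "r < n" "P = even r"
    then have "m \<noteq> k" "m \<noteq> 3 * k + 2" "m \<noteq> 5 * k + 2" "m = 7 * k + 4 \<longleftrightarrow> r = k" "m \<noteq> k + 1"
        "m \<noteq> 5 * k + 3" "m \<noteq> 2 * n + 1"
      using r(1) assms(5,6) by linarith+
    then show ?thesis
      using * by auto
  qed
  finally show ?thesis .
qed

section \<open>Translation to modular inverses and to the stated index formulas\<close>

theorem theorem2: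
  fixes l m n :: nat
  assumes "l \<ge> 1" and "m \<ge> 2" and "n \<ge> 5" and "m \<le> 4 * n"
  shows "enat (lucas l) = inverse_mod (int (lucas m)) (int (lucas n)) \<longleftrightarrow>
      (real l = (real n + 1) / 2 \<and> real m = (real n - 1) / 2 \<and> [n = 1] (mod 4)) \<or>
      (real l = (real n - 1) / 2 \<and> real m = (real n + 1) / 2 \<and> [n = 1] (mod 4)) \<or>
      (real l = (real n + 1) / 2 \<and> real m = (3 * real n + 1) / 2 \<and> odd n) \<or>
      (l = 1 \<and> real m = 2 * real n - (-1) ^ n) \<or>
      (real l = (real n - 1) / 2 \<and> real m = (5 * real n + 1) / 2 \<and> [n = 1] (mod 4)) \<or>
      (real l = (real n + 1) / 2 \<and> real m = (5 * real n - 1) / 2 \<and> [n = 1] (mod 4)) \<or>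
      (real l = (real n + 1) / 2 \<and> real m = (7 * real n + 1) / 2 \<and> odd n)"
proof -
  have *: "enat (lucas l) = inverse_mod (L m) (L n) \<longleftrightarrow> l < n \<and> [L m * L l = 1] (mod L n)"
  proof -
    have "L n \<ge> 1"
      using lucas_pos[of n] by linarith
    have "enat (lucas l) = inverse_mod (L m) (L n) \<longleftrightarrow> inverse_mod (L m) (L n) = enat (lucas l)"
      by (rule eq_commute)
    also have "\<dots> \<longleftrightarrow> lucas l < lucas n \<and> [L m * L l = 1] (mod L n)"
      unfolding inverse_mod_eq_enat_iff[OF \<open>L n \<ge> 1\<close>] by auto
    finally show ?thesis
      using lucas_less_iff[of n l] assms by simp
  qed
  show ?thesis
  proof (cases "even n")
    case True
    then have "\<not> [n = 1] (mod 4)"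
      unfolding cong_def by presburger
    moreover have "real m = 2 * real n - (-1) ^ n \<longleftrightarrow> m + 1 = 2 * n"
      using True by (simp; linarith)
    ultimately show ?thesis
      unfolding * using True assms lucas_mult_cong_1_even[of l n m] by auto
  next
    case False
    then obtain k where n: "n = 2 * k + 1"
      by (elim oddE)
    have n4: "[n = 1] (mod 4) \<longleftrightarrow> even k"
      unfolding cong_def n by presburger
    have half: "(real n + 1) / 2 = real (k + 1)" "(real n - 1) / 2 = real k"
      "(3 * real n + 1) / 2 = real (3 * k + 2)" "(5 * real n + 1) / 2 = real (5 * k + 3)"
      "(5 * real n - 1) / 2 = real (5 * k + 2)" "(7 * real n + 1) / 2 = real (7 * k + 4)"
      "2 * real n - (-1) ^ n = real (2 * n + 1)"
      by (simp_all add: n field_simps)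
    \<comment> \<open>The range condition on the inverse is automatic for each listed value of
      \<open>l\<close>.\<close>
    have "l < n" if "l = k + 1 \<or> l = k \<or> l = 1"
      using that assms n by auto
    then show ?thesis
      unfolding * half n4 of_nat_eq_iff
      using lucas_mult_cong_1_odd[OF assms(1) _ assms(2,4,3) n] False by blast
  qed
qed

end
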